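(* Let $X$ be a completely metrizable topological space of weight $\kappa \ge \aleph_0$, and let $\mathcal{R}$ be a countable family of $G_\delta$ relations on $X$ (each $R\in\mathcal{R}$ is a $G_\delta$ subset of $X^{n}$ for some finite arity $n=n(R)\ge 1$, possibly depending on $R$). Then exactly one of the following two statements holds. (S) There exists an ordinal $\gamma < \kappa^+$ such that every $\mathcal{R}$-clique $A\subseteq X$ has Cantor-Bendixson rank $< \gamma$. (P) There exists a perfect $\mathcal{R}$-clique $P\subseteq X$.
   Context: Given an $n$-ary relation $R \subseteq X^n$, a set $S \subseteq X$ is an $R$-clique if $(s_1,\dots,s_n)\in R$ for all pairwise distinct $s_1,\dots,s_n\in S$. For a family $\mathcal{R}$ of relations on $X$ (possibly of different arities), $S$ is an $\mathcal{R}$-clique if it is an $R$-clique for every $R\in\mathcal{R}$. The weight of a topological space is the least cardinality of an open base. $\kappa^+$ is the successor cardinal of $\kappa$. A set is perfect if (with the subspace topology) it is nonempty, completely metrizable and has no isolated points. For a subset $A$ of a topological space, the Cantor-Bendixson derivatives are taken within $A$: $A^{(0)}=A$, $A^{(\gamma+1)}$ is the set of non-isolated points of the subspace $A^{(\gamma)}$, and $A^{(\lambda)}=\bigcap_{\gamma<\lambda}A^{(\gamma)}$ for limit $\lambda$. The Cantor-Bendixson rank of $A$ is the least ordinal $\gamma$ with $A^{(\gamma)}=\emptyset$, and it is $+\infty$ (above all ordinals) if no such $\gamma$ exists. *)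

theory Defs
  imports "HOL-Analysis.Analysis" "HOL-Algebra.Free_Abelian_Groups"
begin

unbundle cardinal_syntax

(* An n-tuple of points of S is an element of {..<n} \<rightarrow>\<^sub>E S, so that the power X^n is
   product_topology (\<lambda>_. X) {..<n}.  A relation is a pair (n, R) carrying its arity,
   since the empty relation does not determine its arity. *)

definition power_topology :: "'a topology \<Rightarrow> nat \<Rightarrow> (nat \<Rightarrow> 'a) topology" where
  "power_topology X n = product_topology (\<lambda>_. X) {..<n}"

definition rel_clique :: "nat \<Rightarrow> (nat \<Rightarrow> 'a) set \<Rightarrow> 'a set \<Rightarrow> bool" where
  "rel_clique n R S \<longleftrightarrow> (\<forall>s \<in> {..<n} \<rightarrow>\<^sub>E S. inj_on s {..<n} \<longrightarrow> s \<in> R)"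

definition family_clique ::
  "'a topology \<Rightarrow> (nat \<times> (nat \<Rightarrow> 'a) set) set \<Rightarrow> 'a set \<Rightarrow> bool" where
  "family_clique X \<R> S \<longleftrightarrow> S \<subseteq> topspace X \<and> (\<forall>(n, R) \<in> \<R>. rel_clique n R S)"

definition is_open_base :: "'a topology \<Rightarrow> 'a set set \<Rightarrow> bool" where
  "is_open_base X \<B> \<longleftrightarrow>
     (\<forall>V \<in> \<B>. openin X V) \<and>
     (\<forall>U x. openin X U \<and> x \<in> U \<longrightarrow> (\<exists>V \<in> \<B>. x \<in> V \<and> V \<subseteq> U))"

definition has_weight :: "'a topology \<Rightarrow> 'k rel \<Rightarrow> bool" where
  "has_weight X \<kappa> \<longleftrightarrow> Card_order \<kappa> \<and>
     (\<exists>\<B>. is_open_base X \<B> \<and> |\<B>| =o \<kappa>) \<and>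
     (\<forall>\<B>. is_open_base X \<B> \<longrightarrow> \<kappa> \<le>o |\<B>| )"

definition nonisolated :: "'a topology \<Rightarrow> 'a set \<Rightarrow> 'a set" where
  "nonisolated X A = (subtopology X A) derived_set_of A"

lemma nonisolated_alt:
  assumes "A \<subseteq> topspace X"
  shows "nonisolated X A = {x \<in> A. \<not> openin (subtopology X A) {x}}"
proof -
  have "(\<forall>T. x \<in> T \<and> openin (subtopology X A) T \<longrightarrow> (\<exists>y\<noteq>x. y \<in> A \<and> y \<in> T)) \<longleftrightarrow>
        \<not> openin (subtopology X A) {x}" if "x \<in> A" for x
  proof
    assume "\<forall>T. x \<in> T \<and> openin (subtopology X A) T \<longrightarrow> (\<exists>y\<noteq>x. y \<in> A \<and> y \<in> T)"
    then show "\<not> openin (subtopology X A) {x}" by blast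
  next
    assume *: "\<not> openin (subtopology X A) {x}"
    show "\<forall>T. x \<in> T \<and> openin (subtopology X A) T \<longrightarrow> (\<exists>y\<noteq>x. y \<in> A \<and> y \<in> T)"
    proof (intro allI impI, elim conjE)
      fix T assume "x \<in> T" and T: "openin (subtopology X A) T"
      then have "T \<noteq> {x}" "T \<subseteq> A"
        using * openin_subset[OF T] by auto
      then show "\<exists>y\<noteq>x. y \<in> A \<and> y \<in> T"
        using \<open>x \<in> T\<close> by blast
    qed
  qed
  then show ?thesis
    using assms by (auto simp: nonisolated_def derived_set_of_def)
qed

definition perfect_set :: "'a topology \<Rightarrow> 'a set \<Rightarrow> bool" where
  "perfect_set X P \<longleftrightarrow>
     P \<noteq> {} \<and> completely_metrizable_space (subtopology X P) \<and> nonisolated X P = P"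

(* Transfinite iteration along a well-order r: for a in Field r, cb_deriv r X A a is the
   derivative of A whose index is the order type of the proper initial segment below a. *)

definition cb_deriv :: "'o rel \<Rightarrow> 'a topology \<Rightarrow> 'a set \<Rightarrow> 'o \<Rightarrow> 'a set" where
  "cb_deriv r X A =
     wo_rel.worecZSL r A (\<lambda>_. nonisolated X) (\<lambda>D a. \<Inter>b \<in> underS r a. D b)"

lemma cb_deriv_eqs:
  assumes "Well_order r"
  shows "cb_deriv r X A (wo_rel.zero r) = A"
    and "aboveS r a \<noteq> {} \<Longrightarrow>
           cb_deriv r X A (wo_rel.succ r a) = nonisolated X (cb_deriv r X A a)"
    and "wo_rel.isLim r a \<Longrightarrow> a \<noteq> wo_rel.zero r \<Longrightarrow>
           cb_deriv r X A a = (\<Inter>b \<in> underS r a. cb_deriv r X A b)"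
proof -
  interpret wo_rel r using assms by (simp add: wo_rel_def)
  have adm: "adm_woL (\<lambda>D a. \<Inter>b \<in> underS a. D b)"
    unfolding adm_woL_def by auto
  show "cb_deriv r X A zero = A"
    unfolding cb_deriv_def by (rule worecZSL_zero[OF adm])
  show "cb_deriv r X A (succ a) = nonisolated X (cb_deriv r X A a)" if "aboveS a \<noteq> {}"
    unfolding cb_deriv_def by (rule worecZSL_succ[OF adm that])
  show "cb_deriv r X A a = (\<Inter>b \<in> underS a. cb_deriv r X A b)"
    if "isLim a" "a \<noteq> zero"
    unfolding cb_deriv_def by (rule worecZSL_isLim[OF adm that])
qed

(* The derivatives strictly decrease until they stabilise, so an ordinal-valued
   Cantor-Bendixson rank of a set A of elements of 'a has cardinality at most |A|, and hence
   occurs as an index in the cardinal successor of |UNIV :: 'a set|.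
   The rank is the corresponding initial segment; None stands for +\<infinity>. *)

definition cb_rank :: "'a topology \<Rightarrow> 'a set \<Rightarrow> 'a set rel option" where
  "cb_rank X A =
     (let r = cardSuc |UNIV :: 'a set|; E = {a \<in> Field r. cb_deriv r X A a = {}}
      in if E = {} then None else Some (Restr r (underS r (wo_rel.minim r E))))"

definition cb_rank_less :: "'a topology \<Rightarrow> 'a set \<Rightarrow> 'o rel \<Rightarrow> bool" where
  "cb_rank_less X A \<gamma> \<longleftrightarrow> (\<exists>\<rho>. cb_rank X A = Some \<rho> \<and> \<rho> <o \<gamma>)"

end

theory Submission
  imports Defs
begin

text \<open>
A perfect clique equals all of its own derivatives and so has rank \<open>+\<infinity>\<close>, which excludes (S).
The converse is a derivative argument in which a pigeonhole on \<open>\<kappa>\<^sup>+\<close> drives the construction of a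
Cantor scheme.

Suppose (S) fails. Then for every \<open>\<gamma> < \<kappa>\<^sup>+\<close> some clique has a nonempty \<open>\<gamma>\<close>-th derivative. Call a
finite family of open sets large if for every \<open>\<gamma> < \<kappa>\<^sup>+\<close> a single clique has a
\<open>\<gamma>\<close>-th derivative that meets all its members; thus the whole space alone is a large family. The
heart of the proof is that large families split (\<open>large_family_splits\<close>). Given \<open>\<gamma>\<close>, a clique \<open>A\<close>
whose derivative of index \<open>\<gamma> + 1\<close> meets every member \<open>U\<close> has at least two points of its \<open>\<gamma>\<close>-th
derivative in each \<open>U\<close>. These finitely many points form a clique. A clique satisfies every open set
that contains a relation of the family, and satisfaction of finitely many open conditions by finitely
many points persists on small neighbourhoods. Hence there are basic neighbourhoods of the points, two
in each \<open>U\<close>, such that any points chosen from distinct neighbourhoods satisfy the conditions; and each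
neighbourhood meets the \<open>\<gamma>\<close>-th derivative of \<open>A\<close>. The neighbourhoods depend on \<open>\<gamma>\<close>, but there are only \<open>\<kappa>\<close> finite sets of
basic open sets. By regularity of \<open>\<kappa>\<^sup>+\<close>, and because derivatives decrease, one finite set serves all
\<open>\<gamma>\<close> at once (\<open>cardSuc_pigeonhole\<close>), and it is large again.

Iterating with diameters tending to \<open>0\<close>, and taking one more open condition into account at each
step, gives a Cantor scheme. Its limit set is closed and has no isolated points; any distinct points
of it lie in distinct members of all late stages, so their tuple satisfies each open condition.
Since each relation is the intersection of its open conditions, the limit set is a perfect clique
(\<open>cantor_scheme\<close>).
\<close>

section \<open>Cantor-Bendixson derivatives along well-orders\<close>

lemma nonisolated_eq: "nonisolated X A = A \<inter> X derived_set_of A"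
  by (simp add: nonisolated_def derived_set_of_subtopology)

text \<open>
The zero, successor and limit clauses amount to a single recursion equation that mentions only the
predecessors of \<open>a\<close>. In this form the derivatives visibly depend on nothing but the initial segment
below \<open>a\<close>, which is what makes them comparable along different well-orders.
\<close>

lemma cb_deriv_unfold:
  assumes r: "Well_order r" and "a \<in> Field r"
  shows "cb_deriv r X A a = A \<inter> (\<Inter>b \<in> underS r a. nonisolated X (cb_deriv r X A b))"
proof -
  interpret wo_rel r using r by (simp add: wo_rel_def)
  let ?D = "cb_deriv r X A" and ?N = "nonisolated X"
  have "a \<in> Field r \<longrightarrow> ?D a = A \<inter> (\<Inter>b \<in> underS a. ?N (?D b))"
  proof (induction a rule: well_order_inductZSL)
    case Zero
    show ?case by (simp add: cb_deriv_eqs(1)[OF r])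
  next
    case (Suc a)
    have a: "a \<in> Field r"
      using Suc.hyps by (metis FieldI1 succ_in)
    then have under: "under a = insert a (underS a)"
      using REFL by (auto simp: under_def underS_def refl_on_def)
    have "?N (?D a) = A \<inter> (?N (?D a) \<inter> (\<Inter>b \<in> underS a. ?N (?D b)))"
      using Suc.IH a nonisolated_eq[of X "?D a"] by blast
    also have "\<dots> = A \<inter> (\<Inter>b \<in> underS (succ a). ?N (?D b))"
      by (simp add: Suc.hyps under)
    finally show ?case
      by (simp add: cb_deriv_eqs(2)[OF r Suc.hyps])
  next
    case (Lim a)
    have eq: "?D a = (\<Inter>b \<in> underS a. ?D b)"
      by (rule cb_deriv_eqs(3)[OF r Lim.hyps])
    show ?case
    proof (intro impI equalityI subsetI)
      fix x assume a: "a \<in> Field r" and x: "x \<in> ?D a"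
      have "zero \<in> underS a"
        using Lim.hyps(2) a by (simp add: underS_def)
      then have "x \<in> A"
        using x cb_deriv_eqs(1)[OF r, of X A] unfolding eq by auto
      moreover have "x \<in> ?N (?D b)" if b: "b \<in> underS a" for b
      proof -
        \<comment> \<open>A limit \<open>a\<close> above \<open>b\<close> is above \<open>succ b\<close>, whose derivative is \<open>?N (?D b)\<close>.\<close>
        have ab: "aboveS b \<noteq> {}"
          using b by (auto simp: aboveS_def underS_def)
        have "succ b \<in> underS a"
          using b Lim.hyps(1) ab succ_smallest[of b a] isSucc_succ[OF ab]
          by (auto simp: underS_def isLim_def)
        then show ?thesis
          using x cb_deriv_eqs(2)[OF r ab, of X A] unfolding eq by auto
      qed
      ultimately show "x \<in> A \<inter> (\<Inter>b \<in> underS a. ?N (?D b))" by blast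
    next
      fix x assume x: "x \<in> A \<inter> (\<Inter>b \<in> underS a. ?N (?D b))"
      have "x \<in> ?D b" if b: "b \<in> underS a" for b
      proof -
        have "b \<in> Field r" "underS b \<subseteq> underS a"
          using b underS_incr[OF TRANS ANTISYM, of b a]
          by (auto simp: underS_def Field_def)
        with Lim.IH[OF b] x show ?thesis by auto
      qed
      then show "x \<in> ?D a" unfolding eq by auto
    qed
  qed
  with assms(2) show ?thesis by blast
qed

lemma cb_deriv_antimono:
  assumes "Well_order r" "(b, a) \<in> r"
  shows "cb_deriv r X A a \<subseteq> cb_deriv r X A b"
proof -
  interpret wo_rel r using assms by (simp add: wo_rel_def)
  have "underS b \<subseteq> underS a"
    by (rule underS_incr[OF TRANS ANTISYM assms(2)])
  moreover have "a \<in> Field r" "b \<in> Field r"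
    using assms(2) by (auto simp: Field_def)
  ultimately show ?thesis
    by (auto simp: cb_deriv_unfold[OF assms(1), of a] cb_deriv_unfold[OF assms(1), of b])
qed

lemma cb_deriv_less_subset:
  assumes "Well_order r" "b \<in> underS r a"
  shows "cb_deriv r X A a \<subseteq> nonisolated X (cb_deriv r X A b)"
proof -
  have "a \<in> Field r" using assms by (auto simp: underS_def Field_def)
  then show ?thesis
    using assms(2) by (auto simp: cb_deriv_unfold[OF assms(1), of a])
qed

lemma cb_deriv_subset:
  assumes "Well_order r" "a \<in> Field r"
  shows "cb_deriv r X A a \<subseteq> A"
  by (auto simp: cb_deriv_unfold[OF assms])

text \<open>
An embedding maps initial segments onto initial segments, so both sides satisfy the same recursion.
This transports derivatives between \<open>\<kappa>\<^sup>+\<close>, along which the construction below runs, and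
\<open>|UNIV|\<^sup>+\<close>, along which the rank is defined.
\<close>

lemma cb_deriv_embed:
  assumes r: "Well_order r" and s: "Well_order s" and f: "embed r s f" and "a \<in> Field r"
  shows "cb_deriv s X A (f a) = cb_deriv r X A a"
proof -
  interpret wo_rel r using r by (simp add: wo_rel_def)
  have "a \<in> Field r \<longrightarrow> cb_deriv s X A (f a) = cb_deriv r X A a"
  proof (induction a rule: underS_induct)
    case (1 a)
    show ?case
    proof
      assume a: "a \<in> Field r"
      have "f a \<in> Field s" using embed_Field[OF f] a by blast
      then have "cb_deriv s X A (f a) =
          A \<inter> (\<Inter>b \<in> f ` underS a. nonisolated X (cb_deriv s X A b))"
        using cb_deriv_unfold[OF s, of "f a"] embed_underS2[OF r f a] by simp
      also have "\<dots> = A \<inter> (\<Inter>b \<in> underS a. nonisolated X (cb_deriv r X A b))"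
      proof -
        have "cb_deriv s X A (f b) = cb_deriv r X A b" if "b \<in> underS a" for b
          using 1 that by (auto simp: underS_def Field_def)
        then show ?thesis by simp
      qed
      finally show "cb_deriv s X A (f a) = cb_deriv r X A a"
        using cb_deriv_unfold[OF r a, of X A] by simp
    qed
  qed
  with assms show ?thesis by blast
qed

lemma cb_deriv_perfect:
  assumes r: "Well_order r" and P: "nonisolated X P = P" and "a \<in> Field r"
  shows "cb_deriv r X P a = P"
proof -
  interpret wo_rel r using r by (simp add: wo_rel_def)
  have "a \<in> Field r \<longrightarrow> cb_deriv r X P a = P"
  proof (induction a rule: underS_induct)
    case (1 a)
    then have "cb_deriv r X P b = P" if "b \<in> underS a" for b
      using that by (auto simp: underS_def Field_def)
    then show ?case
      using cb_deriv_unfold[OF r, of a X P] P by simp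
  qed
  with assms show ?thesis by blast
qed

lemma cb_rank_perfect:
  fixes X :: "'a topology"
  assumes "perfect_set X P"
  shows "cb_rank X P = None"
proof -
  have "Well_order (cardSuc |UNIV :: 'a set| )"
    by (simp add: cardSuc_Card_order Card_order_wo_rel flip: wo_rel_def)
  then have "{a \<in> Field (cardSuc |UNIV :: 'a set| ). cb_deriv (cardSuc |UNIV :: 'a set| ) X P a = {}} = {}"
    using assms cb_deriv_perfect by (fastforce simp: perfect_set_def)
  then show ?thesis
    unfolding cb_rank_def Let_def by simp
qed

text \<open>
If the derivative of index \<open>a\<close> were empty, the rank would be at most \<open>a\<close> and so less than \<open>b\<close>.
Both a rank \<open>+\<infinity>\<close> and a rank of at least \<open>b\<close> are covered by the failure of \<open>cb_rank_less\<close>.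
\<close>

lemma cb_deriv_nonempty_of_rank_not_less:
  fixes X :: "'a topology" and s :: "'o rel"
  assumes s: "Well_order s" and le: "s \<le>o cardSuc |UNIV :: 'a set|"
    and b: "b \<in> Field s" and a: "a \<in> underS s b"
    and rank: "\<not> cb_rank_less X A (Restr s (underS s b))"
  shows "cb_deriv s X A a \<noteq> {}"
proof
  assume empty: "cb_deriv s X A a = {}"
  let ?r = "cardSuc |UNIV :: 'a set|"
  have r: "Well_order ?r" using le unfolding ordLeq_def by blast
  interpret r: wo_rel ?r using r by (simp add: wo_rel_def)
  interpret s: wo_rel s using s by (simp add: wo_rel_def)
  obtain f where f: "embed s ?r f" using le unfolding ordLeq_def by blast
  define E where "E = {c \<in> Field ?r. cb_deriv ?r X A c = {}}"
  have a': "a \<in> Field s" using a by (auto simp: underS_def Field_def)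
  have fa: "f a \<in> E"
    using embed_Field[OF f] a' cb_deriv_embed[OF s r f a', of X A] empty by (auto simp: E_def)
  have E: "E \<subseteq> Field ?r" by (auto simp: E_def)
  have least: "(r.minim E, f a) \<in> ?r" by (rule r.minim_least[OF E fa])
  have fab: "f a \<in> underS ?r (f b)"
    using embed_underS2[OF s f b] a by blast
  have "(f a, f b) \<in> ?r" using fab by (simp add: underS_def)
  then have "underS ?r (r.minim E) \<subseteq> underS ?r (f b)"
    using underS_incr[OF r.TRANS r.ANTISYM] least by (meson order_trans)
  moreover have "f a \<notin> underS ?r (r.minim E)"
    using r.ANTISYM least unfolding underS_def antisym_def by blast
  ultimately have sub: "underS ?r (r.minim E) \<subset> underS ?r (f b)"
    using fab by blast
  have "Restr ?r (underS ?r (r.minim E)) <o Restr ?r (underS ?r (f b))"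
    using ofilter_subset_ordLess[OF r r.underS_ofilter r.underS_ofilter] sub by blast
  also have "Restr ?r (underS ?r (f b)) =o Restr s (underS s b)"
  proof -
    have "embed (Restr s (underS s b)) ?r f"
      using comp_embed[OF _ f, of "Restr s (underS s b)" id] ofilter_embed[OF s] s.underS_ofilter
      by simp
    from embed_implies_ordIso_Restr[OF r Well_order_Restr[OF s] this]
    show ?thesis
      by (simp add: Field_Restr_ofilter[OF s s.underS_ofilter] embed_underS2[OF s f b] ordIso_symmetric)
  qed
  finally have "Restr ?r (underS ?r (r.minim E)) <o Restr s (underS s b)" .
  moreover have "cb_rank X A = Some (Restr ?r (underS ?r (r.minim E)))"
    using fa unfolding cb_rank_def Let_def E_def[symmetric] by (metis empty_iff)
  ultimately show False
    using rank unfolding cb_rank_less_def by blast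
qed

section \<open>Weight and regular cardinals\<close>

text \<open>
The balls of radius \<open>1 / (n + 1)\<close> form a base of size at most \<open>|UNIV| * \<aleph>\<^sub>0\<close>, and \<open>UNIV\<close> is infinite
because the weight is. As a consequence \<open>\<kappa>\<^sup>+\<close> embeds into the index set of the rank.
\<close>

lemma weight_le_card:
  fixes X :: "'a topology"
  assumes X: "metrizable_space X" and w: "has_weight X \<kappa>" and inf: "natLeq \<le>o \<kappa>"
  shows "\<kappa> \<le>o |UNIV :: 'a set|"
proof -
  obtain M d where "Metric_space M d" and Xeq: "X = Metric_space.mtopology M d"
    using X by (auto simp: metrizable_space_def)
  then interpret Metric_space M d by blast
  define \<B> where "\<B> = (\<lambda>(x, n). mball x (inverse (real (Suc n)))) ` (UNIV :: ('a \<times> nat) set)"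
  have base: "is_open_base X \<B>"
    unfolding is_open_base_def
  proof (intro conjI ballI allI impI)
    show "openin X V" if "V \<in> \<B>" for V
      using that by (auto simp: \<B>_def Xeq)
    fix U x assume "openin X U \<and> x \<in> U"
    then obtain e where e: "e > 0" "mball x e \<subseteq> U" and x: "x \<in> M"
      by (metis Xeq openin_mtopology subsetD)
    obtain n where n: "inverse (real (Suc n)) < e"
      using reals_Archimedean[OF e(1)] by blast
    show "\<exists>V\<in>\<B>. x \<in> V \<and> V \<subseteq> U"
    proof (intro bexI conjI)
      show "mball x (inverse (real (Suc n))) \<in> \<B>"
        by (auto simp: \<B>_def image_iff)
      show "x \<in> mball x (inverse (real (Suc n)))" using x by simp
      show "mball x (inverse (real (Suc n))) \<subseteq> U"
        using n e mball_subset_concentric[of "inverse (real (Suc n))" e x] by force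
    qed
  qed
  have infU: "infinite (UNIV :: 'a set)"
  proof
    assume "finite (UNIV :: 'a set)"
    then have "finite {V. openin X V}"
      by (intro finite_subset[OF _ finite_Pow_iff[THEN iffD2]]) auto
    moreover have "is_open_base X {V. openin X V}"
      by (auto simp: is_open_base_def)
    then have "natLeq \<le>o |{V. openin X V}|"
      using w inf ordLeq_transitive unfolding has_weight_def by blast
    ultimately show False
      using infinite_iff_natLeq_ordLeq by blast
  qed
  have "\<kappa> \<le>o |\<B>|"
    using w base by (auto simp: has_weight_def)
  also have "|\<B>| \<le>o |UNIV :: ('a \<times> nat) set|"
    unfolding \<B>_def by (rule card_of_image)
  also have "|UNIV :: ('a \<times> nat) set| \<le>o |UNIV :: 'a set|"
  proof -
    have "|UNIV :: nat set| \<le>o |UNIV :: 'a set|"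
      using infU infinite_iff_card_of_nat by blast
    from card_of_Times_ordLeq_infinite[OF infU _ this, of "UNIV :: 'a set"]
    show ?thesis by simp
  qed
  finally show ?thesis .
qed

text \<open>
Otherwise every \<open>z\<close> fails at some \<open>g z < \<kappa>\<^sup>+\<close>. By regularity these at most \<open>\<kappa>\<close> indices are bounded by
some \<open>a\<close>, and any \<open>z\<close> that works for \<open>a\<close> also works for \<open>g z\<close>.
\<close>

lemma cardSuc_pigeonhole:
  assumes \<kappa>: "Cinfinite \<kappa>" and Z: "|Z| \<le>o \<kappa>"
    and ex: "\<And>a. a \<in> Field (cardSuc \<kappa>) \<Longrightarrow> \<exists>z \<in> Z. Q a z"
    and mono: "\<And>a b z. (b, a) \<in> cardSuc \<kappa> \<Longrightarrow> Q a z \<Longrightarrow> Q b z"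
  shows "\<exists>z \<in> Z. \<forall>a \<in> Field (cardSuc \<kappa>). Q a z"
proof (rule ccontr)
  let ?r = "cardSuc \<kappa>"
  assume "\<not> ?thesis"
  then obtain g where g: "\<And>z. z \<in> Z \<Longrightarrow> g z \<in> Field ?r \<and> \<not> Q (g z) z"
    by metis
  have co: "Card_order ?r" using \<kappa> by (simp add: cardSuc_Card_order)
  then interpret wo_rel ?r by (simp add: Card_order_wo_rel)
  have "|g ` Z| \<le>o \<kappa>"
    using card_of_image Z ordLeq_transitive by blast
  also have "\<kappa> <o ?r" using \<kappa> by (simp add: cardSuc_greater)
  finally have "\<not> |g ` Z| =o ?r"
    using not_ordLess_ordIso by blast
  moreover have "regularCard ?r" using \<kappa> by (rule regularCard_cardSuc)
  ultimately have "\<not> cofinal (g ` Z) ?r"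
    using g unfolding regularCard_def by blast
  then obtain a where a: "a \<in> Field ?r" "\<And>z. z \<in> Z \<Longrightarrow> a = g z \<or> (a, g z) \<notin> ?r"
    unfolding cofinal_def by blast
  obtain z where z: "z \<in> Z" "Q a z" using ex a(1) by blast
  have "(g z, a) \<in> ?r"
    using a g[OF z(1)] z(1) TOTALS by (metis REFL refl_on_def)
  with mono z g show False by blast
qed

section \<open>Countable families of \<open>G\<^sub>\<delta>\<close> relations\<close>

lemma rel_clique_mono: "rel_clique n R S \<Longrightarrow> T \<subseteq> S \<Longrightarrow> rel_clique n R T"
  using PiE_mono[of "{..<n}" "\<lambda>_. T" "\<lambda>_. S"] unfolding rel_clique_def by blast

text \<open>
Being a clique for a \<open>G\<^sub>\<delta>\<close> relation means being a clique for each of countably many open relations,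
so a countable family of \<open>G\<^sub>\<delta>\<close> relations reduces to one sequence of open relations.
\<close>

lemma family_clique_open_sequence:
  fixes X :: "'a topology"
  assumes "countable \<R>"
    and gd: "\<And>n R. (n, R) \<in> \<R> \<Longrightarrow> gdelta_in (power_topology X n) R"
  obtains g :: "nat \<Rightarrow> nat \<times> (nat \<Rightarrow> 'a) set"
  where "\<And>j. openin (power_topology X (fst (g j))) (snd (g j))"
    and "\<And>S. family_clique X \<R> S \<longleftrightarrow>
           S \<subseteq> topspace X \<and> (\<forall>j. rel_clique (fst (g j)) (snd (g j)) S)"
proof -
  have "\<forall>p \<in> \<R>. \<exists>C :: nat \<Rightarrow> (nat \<Rightarrow> 'a) set. (\<forall>i. openin (power_topology X (fst p)) (C i)) \<and> \<Inter>(range C) = snd p"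
  proof
    fix p assume "p \<in> \<R>"
    then have "gdelta_in (power_topology X (fst p)) (snd p)" using gd by simp
    then show "\<exists>C :: nat \<Rightarrow> (nat \<Rightarrow> 'a) set. (\<forall>i. openin (power_topology X (fst p)) (C i)) \<and> \<Inter>(range C) = snd p"
      unfolding gdelta_in_descending by metis
  qed
  then obtain C :: "nat \<times> (nat \<Rightarrow> 'a) set \<Rightarrow> nat \<Rightarrow> (nat \<Rightarrow> 'a) set"
    where C: "\<And>p i. p \<in> \<R> \<Longrightarrow> openin (power_topology X (fst p)) (C p i)"
    and CR: "\<And>p. p \<in> \<R> \<Longrightarrow> (\<Inter>i. C p i) = snd p"
    by metis
  \<comment> \<open>The full relation of arity 0 imposes no condition; it provides a value for the sequence when
      the family is empty.\<close>
  define W where "W = insert (0, topspace (power_topology X 0))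
    ((\<lambda>(p, i). (fst p, C p i)) ` (\<R> \<times> (UNIV :: nat set)))"
  have "countable W" "W \<noteq> {}"
    using assms(1) by (auto simp: W_def)
  then obtain g :: "nat \<Rightarrow> nat \<times> (nat \<Rightarrow> 'a) set" where g: "range g = W"
    by (metis range_from_nat_into)
  have all: "(\<forall>j. Q (fst (g j)) (snd (g j))) \<longleftrightarrow>
      Q 0 (topspace (power_topology X 0)) \<and> (\<forall>p \<in> \<R>. \<forall>i. Q (fst p) (C p i))" for Q
  proof -
    have "(\<forall>j. Q (fst (g j)) (snd (g j))) \<longleftrightarrow> (\<forall>w \<in> W. Q (fst w) (snd w))"
      using g by (metis UNIV_I image_iff)
    then show ?thesis by (auto simp: W_def)
  qed
  have "\<forall>j. openin (power_topology X (fst (g j))) (snd (g j))"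
    using all[of "\<lambda>n. openin (power_topology X n)"] C by auto
  moreover have "family_clique X \<R> S \<longleftrightarrow>
      S \<subseteq> topspace X \<and> (\<forall>j. rel_clique (fst (g j)) (snd (g j)) S)" for S
  proof -
    have "rel_clique (fst p) (snd p) S \<longleftrightarrow> (\<forall>i. rel_clique (fst p) (C p i) S)" if "p \<in> \<R>" for p
      unfolding rel_clique_def CR[OF that, symmetric] by blast
    moreover have "rel_clique 0 (topspace (power_topology X 0)) S"
      by (auto simp: rel_clique_def power_topology_def)
    ultimately show ?thesis
      using all[of "\<lambda>n G. rel_clique n G S"] by (auto simp: family_clique_def)
  qed
  ultimately show thesis using that by blast
qed

section \<open>Cantor schemes\<close>

text \<open>
One step of a Cantor scheme, from the finite family \<open>F\<close> to the finite family \<open>F'\<close>. Instead of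
indexing the sets by binary words, the step records which inclusions hold between the levels. The
last clause says that every choice of points from distinct members of \<open>F'\<close> satisfies the
relations with index at most \<open>n\<close>.
\<close>

definition splitting ::
  "'a topology \<Rightarrow> ('a \<Rightarrow> 'a \<Rightarrow> real) \<Rightarrow> (nat \<Rightarrow> nat \<times> (nat \<Rightarrow> 'a) set) \<Rightarrow> nat \<Rightarrow>
     'a set set \<Rightarrow> 'a set set \<Rightarrow> bool" where
  "splitting X d g n F F' \<longleftrightarrow>
     finite F' \<and> pairwise disjnt F' \<and> (\<forall>V\<in>F'. openin X V \<and> V \<noteq> {}) \<and>
     (\<forall>U\<in>F. \<exists>V\<in>F'. \<exists>W\<in>F'. V \<noteq> W \<and> X closure_of V \<subseteq> U \<and> X closure_of W \<subseteq> U) \<and>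
     (\<forall>V\<in>F'. \<exists>U\<in>F. X closure_of V \<subseteq> U) \<and>
     (\<forall>V\<in>F'. \<forall>x\<in>V. \<forall>y\<in>V. d x y < inverse (real (Suc n))) \<and>
     (\<forall>j\<le>n. \<forall>t \<in> {..<fst (g j)} \<rightarrow>\<^sub>E F'. inj_on t {..<fst (g j)} \<longrightarrow>
        Pi\<^sub>E {..<fst (g j)} t \<subseteq> snd (g j))"

lemma splittingD:
  assumes "splitting X d g n F F'"
  shows "finite F'" and "pairwise disjnt F'"
    and "\<And>V. V \<in> F' \<Longrightarrow> openin X V \<and> V \<noteq> {}"
    and "\<And>U. U \<in> F \<Longrightarrow>
       \<exists>V\<in>F'. \<exists>W\<in>F'. V \<noteq> W \<and> X closure_of V \<subseteq> U \<and> X closure_of W \<subseteq> U"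
    and "\<And>V. V \<in> F' \<Longrightarrow> \<exists>U\<in>F. X closure_of V \<subseteq> U"
    and "\<And>V x y. V \<in> F' \<Longrightarrow> x \<in> V \<Longrightarrow> y \<in> V \<Longrightarrow> d x y < inverse (real (Suc n))"
    and "\<And>j t. j \<le> n \<Longrightarrow> t \<in> {..<fst (g j)} \<rightarrow>\<^sub>E F' \<Longrightarrow>
       inj_on t {..<fst (g j)} \<Longrightarrow> Pi\<^sub>E {..<fst (g j)} t \<subseteq> snd (g j)"
  using assms unfolding splitting_def by simp_all

context Metric_space
begin

text \<open>
Each member of each level contains a point of \<open>P\<close> by completeness; since it contains two disjoint
members of the next level, it contains two points of \<open>P\<close>, so \<open>P\<close> has no isolated points. \<open>P\<close> is
closed because the levels are finite and the closures of the sets on one level lie in sets of the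
level before. Distinct
points of \<open>P\<close> are eventually separated by the levels, as diameters tend to \<open>0\<close>, and then the
last clause of the splitting step applies to them.
\<close>

lemma cantor_scheme:
  assumes compl: mcomplete and F0: "F 0 \<noteq> {}"
    and step: "\<And>n. splitting mtopology d g n (F n) (F (Suc n))"
  defines "P \<equiv> \<Inter>n. \<Union>(F n)"
  shows "perfect_set mtopology P"
    and "rel_clique (fst (g j)) (snd (g j)) P"
proof -
  let ?cl = "\<lambda>V. mtopology closure_of V"
  note fin = splittingD(1)[OF step] and disj = splittingD(2)[OF step]
    and opn = splittingD(3)[OF step] and split = splittingD(4)[OF step]
    and up = splittingD(5)[OF step] and diam = splittingD(6)[OF step]
    and rel = splittingD(7)[OF step]
  have VM: "V \<subseteq> M" and cl: "V \<subseteq> ?cl V" if "V \<in> F (Suc n)" for V n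
    using opn[OF that] openin_subset[of mtopology V] closure_of_subset[of V mtopology] by auto
  have P_mem: "\<exists>V\<in>F n. x \<in> V" if "x \<in> P" for x n
    using that unfolding P_def by blast
  have PM: "P \<subseteq> M"
    using VM[of _ 0] P_mem[of _ "Suc 0"] by blast
  have anti: "\<Union>(F n) \<subseteq> \<Union>(F m)" if "m \<le> n" for m n
    by (rule lift_Suc_antimono_le[of "\<lambda>n. \<Union>(F n)", OF _ that]) (use up cl in blast)
  have P_closures: "P = (\<Inter>n. \<Union>V\<in>F (Suc n). ?cl V)"
  proof (intro equalityI subsetI)
    fix x assume "x \<in> P"
    then have "\<exists>V\<in>F (Suc n). x \<in> ?cl V" for n
      using P_mem[of x "Suc n"] cl[of _ n] by blast
    then show "x \<in> (\<Inter>n. \<Union>V\<in>F (Suc n). ?cl V)" by blast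
  next
    fix x assume x: "x \<in> (\<Inter>n. \<Union>V\<in>F (Suc n). ?cl V)"
    have "x \<in> \<Union>(F n)" for n
    proof -
      obtain V where "V \<in> F (Suc n)" "x \<in> ?cl V" using x by blast
      then show ?thesis using up by blast
    qed
    then show "x \<in> P" unfolding P_def by blast
  qed
  have closed: "closedin mtopology P"
    unfolding P_closures using fin by (intro closedin_INT closedin_Union) auto
  have meets: "U \<inter> P \<noteq> {}" if U: "U \<in> F n" for U n
  proof -
    \<comment> \<open>A branch of the scheme through \<open>U\<close>; the point is the intersection of its closures.\<close>
    have "\<exists>V. \<forall>i. (V i \<in> F (n + i) \<and> (i = 0 \<longrightarrow> V i = U)) \<and> ?cl (V (Suc i)) \<subseteq> V i"
    proof (rule dependent_nat_choice)
      show "\<exists>V. V \<in> F (n + 0) \<and> (0 = (0 :: nat) \<longrightarrow> V = U)"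
        using U by auto
      fix V i assume "V \<in> F (n + i) \<and> (i = 0 \<longrightarrow> V = U)"
      then show "\<exists>W. (W \<in> F (n + Suc i) \<and> (Suc i = 0 \<longrightarrow> W = U)) \<and> ?cl W \<subseteq> V"
        using split[of V "n + i"] by auto
    qed
    then obtain V where V: "\<And>i. V i \<in> F (n + i)" "V 0 = U" "\<And>i. ?cl (V (Suc i)) \<subseteq> V i"
      by blast
    define C where "C i = ?cl (V (Suc i))" for i
    have VS: "V (Suc i) \<in> F (Suc (n + i))" for i
      using V(1)[of "Suc i"] by simp
    have "\<Inter>(range C) \<noteq> {}"
    proof (rule compl[unfolded mcomplete_nest, rule_format], intro conjI allI impI)
      show "closedin mtopology (C i)" for i by (simp add: C_def)
      show "C i \<noteq> {}" for i
        using opn[OF VS] cl[OF VS] by (force simp: C_def)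
      show "decseq C"
        by (rule decseq_SucI) (use V(3) cl[OF VS] in \<open>force simp: C_def\<close>)
      fix e :: real assume "e > 0"
      then obtain i where i: "inverse (real (Suc i)) < e"
        using reals_Archimedean by blast
      obtain a where a: "a \<in> V (Suc i)" using opn[OF VS] by blast
      have "d a y \<le> e" if "y \<in> V (Suc i)" for y
      proof -
        have "d a y < inverse (real (Suc (n + i)))" by (rule diam[OF VS a that])
        also have "\<dots> \<le> inverse (real (Suc i))" by (simp add: field_simps)
        finally show ?thesis using i by simp
      qed
      then have "V (Suc i) \<subseteq> mcball a e"
        using VM[OF VS[of i]] a by auto
      then have "C i \<subseteq> mcball a e"
        unfolding C_def by (rule closure_of_minimal) simp
      then show "\<exists>i a. C i \<subseteq> mcball a e" by blast
    qed
    then obtain x where x: "\<And>i. x \<in> C i" by blast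
    have "x \<in> \<Union>(F m)" for m
    proof -
      have "x \<in> V m" using x[of m] V(3)[of m] unfolding C_def by blast
      then have "x \<in> \<Union>(F (n + m))" using V(1) by blast
      then show ?thesis using anti[of m "n + m"] by auto
    qed
    moreover have "x \<in> U" using x[of 0] V(2) V(3)[of 0] unfolding C_def by blast
    ultimately show ?thesis unfolding P_def by blast
  qed
  have accum: "x \<in> mtopology derived_set_of P" if x: "x \<in> P" for x
    unfolding metric_derived_set_of
  proof (intro CollectI conjI allI impI)
    show "x \<in> M" using x PM by blast
    fix e :: real assume "e > 0"
    then obtain n where n: "inverse (real (Suc n)) < e"
      using reals_Archimedean by blast
    obtain U where U: "U \<in> F (Suc n)" "x \<in> U" using x unfolding P_def by blast
    obtain V W where VW: "V \<in> F (Suc (Suc n))" "W \<in> F (Suc (Suc n))" "V \<noteq> W"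
      "?cl V \<subseteq> U" "?cl W \<subseteq> U"
      using split[OF U(1)] by blast
    obtain a b where ab: "a \<in> V \<inter> P" "b \<in> W \<inter> P"
      using meets[OF VW(1)] meets[OF VW(2)] by blast
    have "a \<noteq> b"
      using pairwiseD[OF disj VW(1-3)] ab by (auto simp: disjnt_iff)
    moreover have "a \<in> U" "b \<in> U"
      using ab VW(4,5) cl[OF VW(1)] cl[OF VW(2)] by auto
    moreover have "y \<in> mball x e" if "y \<in> U" for y
      using diam[OF U(1) U(2) that] n VM[OF U(1)] U(2) that by auto
    \<comment> \<open>Of two distinct points of \<open>P\<close> near \<open>x\<close>, at least one is not \<open>x\<close>.\<close>
    ultimately have "a \<in> mball x e" "b \<in> mball x e" by blast+
    then show "\<exists>y\<in>P. y \<noteq> x \<and> y \<in> mball x e"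
      using ab \<open>a \<noteq> b\<close> by (metis IntD2)
  qed
  show "perfect_set mtopology P"
    unfolding perfect_set_def
  proof (intro conjI)
    show "P \<noteq> {}" using F0 meets by blast
    have "completely_metrizable_space mtopology"
      using compl Metric_space_axioms unfolding completely_metrizable_space_def by blast
    then show "completely_metrizable_space (subtopology mtopology P)"
      using closed by (rule completely_metrizable_space_closedin)
    show "nonisolated mtopology P = P"
      using accum by (auto simp: nonisolated_eq)
  qed
  show "rel_clique (fst (g j)) (snd (g j)) P"
    unfolding rel_clique_def
  proof (intro ballI impI)
    let ?I = "{..<fst (g j)}"
    fix s assume s: "s \<in> ?I \<rightarrow>\<^sub>E P" "inj_on s ?I"
    have "\<forall>\<^sub>F n in sequentially. \<forall>i\<in>?I. \<forall>k\<in>?I. i \<noteq> k \<longrightarrow> inverse (real (Suc n)) < d (s i) (s k)"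
    proof (intro eventually_ball_finite ballI finite_lessThan)
      fix i k assume ik: "i \<in> ?I" "k \<in> ?I"
      show "\<forall>\<^sub>F n in sequentially. i \<noteq> k \<longrightarrow> inverse (real (Suc n)) < d (s i) (s k)"
      proof (cases "i = k")
        case False
        then have "s i \<noteq> s k" "s i \<in> M" "s k \<in> M"
          using s ik PM by (auto simp: inj_on_def PiE_iff)
        then have "0 < d (s i) (s k)" by simp
        then show ?thesis
          using order_tendstoD(2)[OF LIMSEQ_inverse_real_of_nat]
          by (auto elim: eventually_mono)
      qed auto
    qed
    then obtain N where N: "\<And>n i k. n \<ge> N \<Longrightarrow> i \<in> ?I \<Longrightarrow> k \<in> ?I \<Longrightarrow> i \<noteq> k \<Longrightarrow>
        inverse (real (Suc n)) < d (s i) (s k)"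
      unfolding eventually_sequentially by blast
    define n where "n = max N j"
    have n: "n \<ge> j" "\<And>i k. i \<in> ?I \<Longrightarrow> k \<in> ?I \<Longrightarrow> i \<noteq> k \<Longrightarrow>
        inverse (real (Suc n)) < d (s i) (s k)"
      using N[of n] by (auto simp: n_def)
    have "\<forall>i\<in>?I. \<exists>U\<in>F (Suc n). s i \<in> U"
      using s(1) unfolding P_def by blast
    then obtain t0 where t0: "\<And>i. i \<in> ?I \<Longrightarrow> t0 i \<in> F (Suc n) \<and> s i \<in> t0 i"
      by metis
    define t where "t = restrict t0 ?I"
    have "t \<in> ?I \<rightarrow>\<^sub>E F (Suc n)" using t0 by (auto simp: t_def)
    \<comment> \<open>Two of the points in the same set would be closer than \<open>1 / (n + 1)\<close>.\<close>
    moreover have "inj_on t ?I"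
    proof (rule inj_onI, rule ccontr)
      fix i k assume ik: "i \<in> ?I" "k \<in> ?I" "t i = t k" "i \<noteq> k"
      then have "s i \<in> t0 i" "s k \<in> t0 i" "t0 i \<in> F (Suc n)"
        using t0[of i] t0[of k] by (auto simp: t_def)
      then show False
        using diam[of "t0 i" n "s i" "s k"] n(2)[OF ik(1,2,4)] by linarith
    qed
    moreover have "s \<in> Pi\<^sub>E ?I t"
      using s(1) t0 by (auto simp: t_def PiE_iff)
    ultimately show "s \<in> snd (g j)"
      using rel[OF n(1), of t] by blast
  qed
qed

section \<open>Splitting large families\<close>

lemma eventually_mcball_subset:
  assumes "openin mtopology U" "x \<in> U"
  shows "\<forall>\<^sub>F r in at_right 0. mcball x r \<subseteq> U"
proof -
  obtain e where "e > 0" "mcball x e \<subseteq> U"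
    using assms by (metis openin_mtopology_mcball)
  then show ?thesis
    unfolding eventually_at_right_field
    by (metis less_imp_le mcball_subset_concentric order_trans)
qed

lemma eventually_cube_subset:
  assumes "openin (power_topology mtopology k) G" "s \<in> G"
  shows "\<forall>\<^sub>F r in at_right 0. (\<Pi>\<^sub>E i\<in>{..<k}. mball (s i) r) \<subseteq> G"
proof -
  obtain U where U: "\<And>i. i \<in> {..<k} \<Longrightarrow> openin mtopology (U i)"
    "s \<in> Pi\<^sub>E {..<k} U" "Pi\<^sub>E {..<k} U \<subseteq> G"
    using assms unfolding power_topology_def openin_product_topology_alt by metis
  have "\<forall>\<^sub>F r in at_right 0. \<forall>i\<in>{..<k}. mcball (s i) r \<subseteq> U i"
    using U(1,2) by (intro eventually_ball_finite ballI eventually_mcball_subset) auto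
  then show ?thesis
  proof eventually_elim
    case (elim r)
    then have "(\<Pi>\<^sub>E i\<in>{..<k}. mball (s i) r) \<subseteq> Pi\<^sub>E {..<k} U"
      by (intro PiE_mono) (meson mball_subset_mcball order_trans)
    with U(3) show ?case by blast
  qed
qed

text \<open>
Only finitely many conditions are imposed, each of which holds for all sufficiently small radii
\<open>r\<close> when \<open>V x\<close> is the ball of radius \<open>r\<close> around \<open>x\<close>; for the relations this uses that the
finitely many injective tuples from \<open>D\<close> satisfy them. Shrinking the balls to basic sets preserves the
conditions.
\<close>

lemma clique_small_neighbourhoods:
  assumes D: "finite D" "D \<subseteq> M" and F: "finite F" "\<And>U. U \<in> F \<Longrightarrow> openin mtopology U"
    and J: "finite J" "\<And>k G. (k, G) \<in> J \<Longrightarrow> openin (power_topology mtopology k) G"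
      "\<And>k G. (k, G) \<in> J \<Longrightarrow> rel_clique k G D"
    and e: "e > 0" and B: "is_open_base mtopology B"
  obtains V where "\<And>x. x \<in> D \<Longrightarrow> V x \<in> B \<and> x \<in> V x"
    and "\<And>x y. x \<in> D \<Longrightarrow> y \<in> D \<Longrightarrow> x \<noteq> y \<Longrightarrow> disjnt (V x) (V y)"
    and "\<And>x U. x \<in> D \<Longrightarrow> U \<in> F \<Longrightarrow> x \<in> U \<Longrightarrow> mtopology closure_of V x \<subseteq> U"
    and "\<And>x y z. x \<in> D \<Longrightarrow> y \<in> V x \<Longrightarrow> z \<in> V x \<Longrightarrow> d y z < e"
    and "\<And>k G s. (k, G) \<in> J \<Longrightarrow> s \<in> {..<k} \<rightarrow>\<^sub>E D \<Longrightarrow> inj_on s {..<k} \<Longrightarrow>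
           (\<Pi>\<^sub>E i\<in>{..<k}. V (s i)) \<subseteq> G"
proof -
  have less: "\<forall>\<^sub>F r in at_right 0. 2 * r < c" if "c > 0" for c :: real
    unfolding eventually_at_right_field using that by (intro exI[of _ "c / 2"]) auto
  have imp: "\<forall>\<^sub>F r in at_right 0. Q \<longrightarrow> R r" if "Q \<Longrightarrow> \<forall>\<^sub>F r in at_right 0. R r"
    for Q and R :: "real \<Rightarrow> bool"
    using that by (cases Q) auto
  have "\<forall>\<^sub>F r in at_right 0. r > (0 :: real)"
    by (rule eventually_at_right_less)
  moreover have "\<forall>\<^sub>F r in at_right 0. \<forall>U\<in>F. \<forall>x\<in>D. x \<in> U \<longrightarrow> mcball x r \<subseteq> U"
    using eventually_mcball_subset F(2)
    by (intro eventually_ball_finite ballI D F(1) imp) auto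
  moreover have "\<forall>\<^sub>F r in at_right 0. \<forall>x\<in>D. \<forall>y\<in>D. x \<noteq> y \<longrightarrow> 2 * r < d x y"
    using D(2) by (intro eventually_ball_finite ballI D(1) imp less) (auto intro: mdist_pos_less)
  moreover have "\<forall>\<^sub>F r in at_right 0. \<forall>p\<in>J. \<forall>s\<in>{..<fst p} \<rightarrow>\<^sub>E D. inj_on s {..<fst p} \<longrightarrow>
      (\<Pi>\<^sub>E i\<in>{..<fst p}. mball (s i) r) \<subseteq> snd p"
    using D(1) J(2,3) unfolding rel_clique_def
    by (intro eventually_ball_finite ballI J(1) imp finite_PiE eventually_cube_subset) auto
  moreover have "\<forall>\<^sub>F r in at_right 0. 2 * r < e"
    by (rule less[OF e])
  ultimately have "\<forall>\<^sub>F r in at_right 0. r > 0 \<and> (\<forall>U\<in>F. \<forall>x\<in>D. x \<in> U \<longrightarrow> mcball x r \<subseteq> U) \<and>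
      (\<forall>x\<in>D. \<forall>y\<in>D. x \<noteq> y \<longrightarrow> 2 * r < d x y) \<and>
      (\<forall>p\<in>J. \<forall>s\<in>{..<fst p} \<rightarrow>\<^sub>E D. inj_on s {..<fst p} \<longrightarrow>
        (\<Pi>\<^sub>E i\<in>{..<fst p}. mball (s i) r) \<subseteq> snd p) \<and> 2 * r < e"
    by eventually_elim blast
  then obtain r where r0: "r > 0 \<and> (\<forall>U\<in>F. \<forall>x\<in>D. x \<in> U \<longrightarrow> mcball x r \<subseteq> U) \<and>
      (\<forall>x\<in>D. \<forall>y\<in>D. x \<noteq> y \<longrightarrow> 2 * r < d x y) \<and>
      (\<forall>p\<in>J. \<forall>s\<in>{..<fst p} \<rightarrow>\<^sub>E D. inj_on s {..<fst p} \<longrightarrow>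
        (\<Pi>\<^sub>E i\<in>{..<fst p}. mball (s i) r) \<subseteq> snd p) \<and> 2 * r < e"
    by (elim exE[OF eventually_happens'[OF trivial_limit_at_right_real]])
  have r: "r > 0" "\<And>U x. U \<in> F \<Longrightarrow> x \<in> D \<Longrightarrow> x \<in> U \<Longrightarrow> mcball x r \<subseteq> U"
    "\<And>x y. x \<in> D \<Longrightarrow> y \<in> D \<Longrightarrow> x \<noteq> y \<Longrightarrow> 2 * r < d x y"
    "\<And>p s. p \<in> J \<Longrightarrow> s \<in> {..<fst p} \<rightarrow>\<^sub>E D \<Longrightarrow> inj_on s {..<fst p} \<Longrightarrow>
      (\<Pi>\<^sub>E i\<in>{..<fst p}. mball (s i) r) \<subseteq> snd p" "2 * r < e"
    using r0 by simp_all
  have "\<forall>x\<in>D. \<exists>V\<in>B. x \<in> V \<and> V \<subseteq> mball x r"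
    using B D(2) r(1) unfolding is_open_base_def by (metis centre_in_mball_iff openin_mball subsetD)
  then obtain V where V: "\<And>x. x \<in> D \<Longrightarrow> V x \<in> B \<and> x \<in> V x \<and> V x \<subseteq> mball x r"
    by metis
  show thesis
  proof (rule that[of V])
    show "V x \<in> B \<and> x \<in> V x" if "x \<in> D" for x using V that by blast
    show "disjnt (V x) (V y)" if "x \<in> D" "y \<in> D" "x \<noteq> y" for x y
    proof -
      have "disjnt (mball x r) (mball y r)"
        using r(3)[OF that] by (intro disjoint_mball) simp
      then show ?thesis using V that by (meson disjnt_subset1 disjnt_subset2)
    qed
    show "mtopology closure_of V x \<subseteq> U" if "x \<in> D" "U \<in> F" "x \<in> U" for x U
    proof -
      have "V x \<subseteq> mcball x r" using V[OF that(1)] mball_subset_mcball by blast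
      then have "mtopology closure_of V x \<subseteq> mcball x r" by (rule closure_of_minimal) simp
      then show ?thesis using r(2) that by blast
    qed
    show "d y z < e" if "x \<in> D" "y \<in> V x" "z \<in> V x" for x y z
    proof -
      have "y \<in> mball x r" "z \<in> mball x r" using V that by blast+
      then show ?thesis
        using triangle[of y x z] commute[of x y] r(5) by auto
    qed
    show "(\<Pi>\<^sub>E i\<in>{..<k}. V (s i)) \<subseteq> G"
      if "(k, G) \<in> J" "s \<in> {..<k} \<rightarrow>\<^sub>E D" "inj_on s {..<k}" for k G s
    proof -
      have "(\<Pi>\<^sub>E i\<in>{..<k}. V (s i)) \<subseteq> (\<Pi>\<^sub>E i\<in>{..<k}. mball (s i) r)"
        using V that(2) by (intro PiE_mono) auto
      also have "\<dots> \<subseteq> G" using r(4)[OF that(1), of s] that(2,3) by simp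
      finally show ?thesis .
    qed
  qed
qed

end

text \<open>
It is essential that for each \<open>a\<close> one and the same set \<open>A\<close> serves all members of \<open>F\<close>: the points
chosen from different members then jointly form a clique.
\<close>

definition large_family ::
  "'o rel \<Rightarrow> 'a topology \<Rightarrow> ('a set \<Rightarrow> bool) \<Rightarrow> 'a set set \<Rightarrow> bool" where
  "large_family r X C F \<longleftrightarrow>
     (\<forall>a \<in> Field r. \<exists>A. C A \<and> (\<forall>U \<in> F. U \<inter> cb_deriv r X A a \<noteq> {}))"

text \<open>
For a fixed index \<open>a\<close>, a witness for some \<open>b > a\<close> has in each \<open>U\<close> a point of the \<open>b\<close>-th derivative,
which is a limit of points of the \<open>a\<close>-th; this provides two points in \<open>U\<close> and a splitting
into basic sets that all meet the \<open>a\<close>-th derivative. The pigeonhole principle then makes the splitting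
independent of \<open>a\<close>.
\<close>

lemma (in Metric_space) large_family_splits:
  fixes \<kappa> :: "'k rel" and B :: "'a set set"
  assumes \<kappa>: "Cinfinite \<kappa>" and B: "is_open_base mtopology B" "|B| =o \<kappa>"
    and g: "\<And>j. openin (power_topology mtopology (fst (g j))) (snd (g j))"
    and C: "\<And>A. C A \<Longrightarrow> A \<subseteq> M \<and> (\<forall>j. rel_clique (fst (g j)) (snd (g j)) A)"
    and F: "finite F" "\<And>U. U \<in> F \<Longrightarrow> openin mtopology U"
    and large: "large_family (cardSuc \<kappa>) mtopology C F"
  shows "\<exists>F'. splitting mtopology d g n F F' \<and> large_family (cardSuc \<kappa>) mtopology C F'"
proof -
  let ?r = "cardSuc \<kappa>"
  let ?D = "cb_deriv ?r mtopology"
  \<comment> \<open>Splittings into basic sets: the restriction to a base of size \<open>\<kappa>\<close> is what limits their number.\<close>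
  define Z where "Z = {F' \<in> Fpow B. splitting mtopology d g n F F'}"
  have r_inf: "Card_order ?r" "infinite (Field ?r)"
    using Cinfinite_cardSuc[OF \<kappa>] by (auto simp: cinfinite_def)
  then have r: "Well_order ?r" by simp
  have "infinite B"
    using \<kappa> card_of_ordIso_finite_Field[OF _ ordIso_symmetric[OF B(2)]]
    by (auto simp: cinfinite_def)
  then have "|Fpow B| =o \<kappa>"
    using card_of_Fpow_infinite B(2) ordIso_transitive by blast
  moreover have "|Z| \<le>o |Fpow B|"
    by (rule card_of_mono1) (auto simp: Z_def)
  ultimately have Z: "|Z| \<le>o \<kappa>"
    using ordLeq_ordIso_trans by blast
  have "\<exists>F'\<in>Z. \<forall>a\<in>Field ?r. \<exists>A. C A \<and> (\<forall>V\<in>F'. V \<inter> ?D A a \<noteq> {})"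
  proof (rule cardSuc_pigeonhole[OF \<kappa> Z])
    fix a b F' assume ba: "(b, a) \<in> ?r" and "\<exists>A. C A \<and> (\<forall>V\<in>F'. V \<inter> ?D A a \<noteq> {})"
    then obtain A where "C A" "\<forall>V\<in>F'. V \<inter> ?D A a \<noteq> {}" by blast
    moreover have "?D A a \<subseteq> ?D A b" by (rule cb_deriv_antimono[OF r ba])
    ultimately show "\<exists>A. C A \<and> (\<forall>V\<in>F'. V \<inter> ?D A b \<noteq> {})" by fast
  next
    fix a assume a: "a \<in> Field ?r"
    obtain b where b: "b \<in> Field ?r" "a \<noteq> b" "(a, b) \<in> ?r"
      using infinite_Card_order_limit[OF r_inf a] by blast
    obtain A where A: "C A" "\<And>U. U \<in> F \<Longrightarrow> U \<inter> ?D A b \<noteq> {}"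
      using large b(1) unfolding large_family_def by blast
    have "\<exists>x y. x \<in> U \<inter> ?D A a \<and> y \<in> U \<inter> ?D A a \<and> x \<noteq> y" if U: "U \<in> F" for U
    proof -
      obtain x where x: "x \<in> U" "x \<in> ?D A b" using A(2)[OF U] by blast
      have "x \<in> nonisolated mtopology (?D A a)"
        using cb_deriv_less_subset[OF r, of a b mtopology A] b x(2) by (auto simp: underS_def)
      then have xD: "x \<in> ?D A a" "x \<in> mtopology derived_set_of (?D A a)"
        by (auto simp: nonisolated_eq)
      then obtain y where "y \<noteq> x" "y \<in> ?D A a" "y \<in> U"
        using F(2)[OF U] x(1) unfolding in_derived_set_of by blast
      with x xD show ?thesis by blast
    qed
    then obtain p q where pq: "\<And>U. U \<in> F \<Longrightarrow>
        p U \<in> U \<inter> ?D A a \<and> q U \<in> U \<inter> ?D A a \<and> p U \<noteq> q U"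
      by metis
    define D where "D = p ` F \<union> q ` F"
    have D: "finite D" "D \<subseteq> ?D A a" using F(1) pq by (auto simp: D_def)
    then have DA: "D \<subseteq> A" using cb_deriv_subset[OF r a, of mtopology A] by blast
    obtain V where V: "\<And>x. x \<in> D \<Longrightarrow> V x \<in> B \<and> x \<in> V x"
      "\<And>x y. x \<in> D \<Longrightarrow> y \<in> D \<Longrightarrow> x \<noteq> y \<Longrightarrow> disjnt (V x) (V y)"
      "\<And>x U. x \<in> D \<Longrightarrow> U \<in> F \<Longrightarrow> x \<in> U \<Longrightarrow> mtopology closure_of V x \<subseteq> U"
      "\<And>x y z. x \<in> D \<Longrightarrow> y \<in> V x \<Longrightarrow> z \<in> V x \<Longrightarrow> d y z < inverse (real (Suc n))"
      "\<And>k G s. (k, G) \<in> g ` {..n} \<Longrightarrow> s \<in> {..<k} \<rightarrow>\<^sub>E D \<Longrightarrow> inj_on s {..<k} \<Longrightarrow>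
         (\<Pi>\<^sub>E i\<in>{..<k}. V (s i)) \<subseteq> G"
    proof (rule clique_small_neighbourhoods[OF D(1) _ F, of "g ` {..n}" "inverse (real (Suc n))" B])
      show "D \<subseteq> M" using DA C[OF A(1)] by blast
      show "openin (power_topology mtopology k) G" if "(k, G) \<in> g ` {..n}" for k G
        using that g by (metis fst_conv imageE snd_conv)
      show "rel_clique k G D" if "(k, G) \<in> g ` {..n}" for k G
        using that C[OF A(1)] DA by (metis fst_conv imageE snd_conv rel_clique_mono)
    qed (use B in auto)
    have V_inj: "V x \<noteq> V y" if "x \<in> D" "y \<in> D" "x \<noteq> y" for x y
      using V(1,2) that by (metis disjnt_iff)
    have "splitting mtopology d g n F (V ` D)"
      unfolding splitting_def
    proof (intro conjI)
      show "finite (V ` D)" using D(1) by simp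
      show "pairwise disjnt (V ` D)" using V(2) by (auto simp: pairwise_def)
      show "\<forall>V'\<in>V ` D. openin mtopology V' \<and> V' \<noteq> {}"
        using V(1) B(1) unfolding is_open_base_def by blast
      show "\<forall>U\<in>F. \<exists>V'\<in>V ` D. \<exists>W\<in>V ` D. V' \<noteq> W \<and>
          mtopology closure_of V' \<subseteq> U \<and> mtopology closure_of W \<subseteq> U"
      proof
        fix U assume U: "U \<in> F"
        then have pqD: "p U \<in> D" "q U \<in> D" by (auto simp: D_def)
        have "V (p U) \<noteq> V (q U)" using V_inj pqD pq[OF U] by blast
        moreover have "mtopology closure_of V (p U) \<subseteq> U" "mtopology closure_of V (q U) \<subseteq> U"
          using V(3)[OF pqD(1) U] V(3)[OF pqD(2) U] pq[OF U] by auto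
        ultimately show "\<exists>V'\<in>V ` D. \<exists>W\<in>V ` D. V' \<noteq> W \<and>
            mtopology closure_of V' \<subseteq> U \<and> mtopology closure_of W \<subseteq> U"
          using pqD by blast
      qed
      show "\<forall>V'\<in>V ` D. \<exists>U\<in>F. mtopology closure_of V' \<subseteq> U"
      proof
        fix V' assume "V' \<in> V ` D"
        then obtain x where x: "x \<in> D" "V' = V x" by blast
        then obtain U where "U \<in> F" "x \<in> U" using pq unfolding D_def by blast
        then show "\<exists>U\<in>F. mtopology closure_of V' \<subseteq> U" using V(3) x by blast
      qed
      show "\<forall>V'\<in>V ` D. \<forall>x\<in>V'. \<forall>y\<in>V'. d x y < inverse (real (Suc n))"
        using V(4) by blast
      show "\<forall>j\<le>n. \<forall>t\<in>{..<fst (g j)} \<rightarrow>\<^sub>E V ` D. inj_on t {..<fst (g j)} \<longrightarrow>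
          Pi\<^sub>E {..<fst (g j)} t \<subseteq> snd (g j)"
      proof (intro allI impI ballI)
        fix j t
        let ?I = "{..<fst (g j)}"
        assume j: "j \<le> n" and t: "t \<in> ?I \<rightarrow>\<^sub>E V ` D" "inj_on t ?I"
        have "\<forall>i\<in>?I. \<exists>x\<in>D. t i = V x" using t(1) by (auto simp: PiE_iff)
        then obtain s0 where s0: "\<And>i. i \<in> ?I \<Longrightarrow> s0 i \<in> D \<and> t i = V (s0 i)"
          by metis
        \<comment> \<open>A tuple of distinct members of \<open>V ` D\<close> comes from a tuple of distinct points of \<open>D\<close>.\<close>
        define s where "s = restrict s0 ?I"
        have "s \<in> ?I \<rightarrow>\<^sub>E D" using s0 by (auto simp: s_def)
        moreover have "inj_on s ?I"
          using t(2) s0 by (auto simp: s_def inj_on_def)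
        moreover have "(fst (g j), snd (g j)) \<in> g ` {..n}" using j by simp
        ultimately have "(\<Pi>\<^sub>E i\<in>?I. V (s i)) \<subseteq> snd (g j)" by (intro V(5))
        moreover have "(\<Pi>\<^sub>E i\<in>?I. V (s i)) = Pi\<^sub>E ?I t"
          using s0 by (intro PiE_cong) (simp add: s_def)
        ultimately show "Pi\<^sub>E ?I t \<subseteq> snd (g j)" by simp
      qed
    qed
    moreover have "V ` D \<in> Fpow B"
      using D(1) V(1) by (auto simp: Fpow_def)
    moreover have "\<forall>V'\<in>V ` D. V' \<inter> ?D A a \<noteq> {}"
      using V(1) D(2) by blast
    ultimately show "\<exists>F'\<in>Z. \<exists>A. C A \<and> (\<forall>V\<in>F'. V \<inter> ?D A a \<noteq> {})"
      using A(1) unfolding Z_def by blast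
  qed
  then show ?thesis
    unfolding Z_def large_family_def by blast
qed

section \<open>The dichotomy\<close>

text \<open>
An index \<open>a\<close> of \<open>\<kappa>\<^sup>+\<close> has some \<open>b\<close> above it, and the initial segment below \<open>b\<close> is an admissible bound
\<open>\<gamma>\<close>. A clique whose rank is not below it has a nonempty derivative of index \<open>a\<close>.
\<close>

lemma large_topspace:
  fixes X :: "'a topology" and \<kappa> :: "'k rel"
  assumes \<kappa>: "Cinfinite \<kappa>" and le: "\<kappa> \<le>o |UNIV :: 'a set|"
    and C: "\<And>A. C A \<Longrightarrow> A \<subseteq> topspace X"
    and unbounded: "\<And>\<gamma> :: 'k set rel. Well_order \<gamma> \<Longrightarrow> \<gamma> <o cardSuc \<kappa> \<Longrightarrow>
      \<exists>A. C A \<and> \<not> cb_rank_less X A \<gamma>"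
  shows "large_family (cardSuc \<kappa>) X C {topspace X}"
  unfolding large_family_def
proof
  let ?r = "cardSuc \<kappa>"
  fix a assume a: "a \<in> Field ?r"
  have r_inf: "Card_order ?r" "infinite (Field ?r)"
    using Cinfinite_cardSuc[OF \<kappa>] by (auto simp: cinfinite_def)
  then have r: "Well_order ?r" by simp
  obtain b where b: "b \<in> Field ?r" "a \<noteq> b" "(a, b) \<in> ?r"
    using infinite_Card_order_limit[OF r_inf a] by blast
  have "Restr ?r (underS ?r b) <o ?r"
    using underS_Restr_ordLess[OF r] a by blast
  then obtain A where A: "C A" "\<not> cb_rank_less X A (Restr ?r (underS ?r b))"
    using unbounded[OF Well_order_Restr[OF r]] by blast
  have "?r \<le>o cardSuc |UNIV :: 'a set|"
    using le \<kappa> by (simp add: cardSuc_mono_ordLeq)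
  then have "cb_deriv ?r X A a \<noteq> {}"
    using b A(2) by (intro cb_deriv_nonempty_of_rank_not_less[OF r]) (auto simp: underS_def)
  then show "\<exists>A. C A \<and> (\<forall>U\<in>{topspace X}. U \<inter> cb_deriv ?r X A a \<noteq> {})"
    using A(1) C[OF A(1)] cb_deriv_subset[OF r a, of X A] by blast
qed

theorem theorem1p2:
  fixes X :: "'a topology"
    and \<kappa> :: "'k rel"
    and \<R> :: "(nat \<times> (nat \<Rightarrow> 'a) set) set"
  assumes "completely_metrizable_space X"
    and "has_weight X \<kappa>"
    and "natLeq \<le>o \<kappa>"
    and "countable \<R>"
    and "\<And>n R. (n, R) \<in> \<R> \<Longrightarrow> n \<ge> 1 \<and> gdelta_in (power_topology X n) R"
  defines "S \<equiv> (\<exists>\<gamma> :: 'k set rel. Well_order \<gamma> \<and> \<gamma> <o cardSuc \<kappa> \<and>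
                  (\<forall>A. family_clique X \<R> A \<longrightarrow> cb_rank_less X A \<gamma>))"
    and "P \<equiv> (\<exists>P. family_clique X \<R> P \<and> perfect_set X P)"
  shows "(S \<or> P) \<and> \<not> (S \<and> P)"
proof -
  obtain M d where "Metric_space M d" and compl: "Metric_space.mcomplete M d"
    and X: "X = Metric_space.mtopology M d"
    using assms(1) by (auto simp: completely_metrizable_space_def)
  then interpret Metric_space M d by blast
  obtain B where B: "is_open_base X B" "|B| =o \<kappa>" and "Card_order \<kappa>"
    using assms(2) by (auto simp: has_weight_def)
  then have \<kappa>: "Cinfinite \<kappa>"
    using cinfinite_mono[OF assms(3) natLeq_cinfinite] by blast
  have "\<not> (S \<and> P)"
    using cb_rank_perfect by (force simp: S_def P_def cb_rank_less_def)
  moreover have P if "\<not> S"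
  proof -
    let ?C = "family_clique X \<R>"
    obtain g :: "nat \<Rightarrow> nat \<times> (nat \<Rightarrow> 'a) set"
      where g: "\<And>j. openin (power_topology X (fst (g j))) (snd (g j))"
        "\<And>A. ?C A \<longleftrightarrow> A \<subseteq> topspace X \<and> (\<forall>j. rel_clique (fst (g j)) (snd (g j)) A)"
      using family_clique_open_sequence[OF assms(4), of X] assms(5) by metis
    have "\<kappa> \<le>o |UNIV :: 'a set|"
      using completely_metrizable_imp_metrizable_space[OF assms(1)] assms(2,3)
      by (rule weight_le_card)
    then have large: "large_family (cardSuc \<kappa>) X ?C {topspace X}"
      using \<kappa> \<open>\<not> S\<close> by (intro large_topspace) (auto simp: S_def family_clique_def)
    define good where "good F \<longleftrightarrow> finite F \<and> F \<noteq> {} \<and> (\<forall>U\<in>F. openin X U) \<and>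
      large_family (cardSuc \<kappa>) X ?C F" for F
    have "\<exists>F. \<forall>n. good (F n) \<and> splitting X d g n (F n) (F (Suc n))"
    proof (rule dependent_nat_choice)
      show "\<exists>F. good F"
        using large by (intro exI[of _ "{topspace X}"]) (simp add: good_def)
      fix F n assume F: "good F"
      have "\<exists>F'. splitting X d g n F F' \<and> large_family (cardSuc \<kappa>) X ?C F'"
        unfolding X
        by (rule large_family_splits[OF \<kappa> B[unfolded X]])
          (use F g in \<open>auto simp: good_def X\<close>)
      then obtain F' where F': "splitting X d g n F F'" "large_family (cardSuc \<kappa>) X ?C F'"
        by blast
      moreover have "good F'"
        using F splittingD(1,3,4)[OF F'(1)] F'(2) unfolding good_def by blast
      ultimately show "\<exists>F'. good F' \<and> splitting X d g n F F'" by blast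
    qed
    then obtain F where F: "\<And>n. good (F n)" "\<And>n. splitting X d g n (F n) (F (Suc n))"
      by blast
    have "F 0 \<noteq> {}" using F(1) by (simp add: good_def)
    note scheme = cantor_scheme[OF compl this F(2)[unfolded X]]
    have "\<Union>(F 0) \<subseteq> topspace X"
      using F(1)[of 0] openin_subset unfolding good_def by blast
    then have "(\<Inter>n. \<Union>(F n)) \<subseteq> topspace X" by blast
    then have "?C (\<Inter>n. \<Union>(F n))"
      using scheme(2) by (simp add: g(2))
    with scheme(1) show P unfolding P_def X by blast
  qed
  ultimately show ?thesis by blast
qed

end
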